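(* Assume that $\mu_*$ is a Gaussian mixture on $\mathbb R^d$, i.e. it has density $$\mu_*(x)=\sum_{k=1}^Mc_k\frac1{(\sqrt{2\pi})^d\,a_k}\exp\Big(-\tfrac12(x-b_k)\cdot A_k^{-1}(x-b_k)\Big),$$ where the $A_k$ are positive definite (symmetric) matrices, $a_k=\sqrt{\det A_k}$, $b_k\in\mathbb R^d$ are constant vectors, $c_k>0$ and $\sum_{k=1}^Mc_k=1$. Then for any positive integer $\ell$ and any multi-index $\alpha$ with $|\alpha|\le\ell$ there is a constant $C(\ell,\mu_* )$, depending on $\ell$ and on the $A_k,b_k$, such that for any $x\in\mathbb R^d$ and any $t\ge0$, $$\frac{|\partial_x^\alpha q_t(x)|}{q_t(x)}\le C(\ell,\mu_* )\,\|x\|_2^\ell+C(\ell,\mu_* ) .$$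
   Context: $\lambda_t=e^{-t}$, $\sigma_t=\sqrt{1-e^{-2t}}$, and $q_t$ is the density of $\lambda_tX_0+\sigma_tW$ with $X_0\sim\mu_*$ and $W\sim\mathcal N(0,\mathbb I_d)$ independent (so $q_0=\mu_*$). Multi-indices: $|\alpha|=\sum_i\alpha_i$, $\partial_x^\alpha=\partial_{x_1}^{\alpha_1}\cdots\partial_{x_d}^{\alpha_d}$. *)

theory Defs
  imports "HOL-Probability.Probability"
begin

definition pos_def :: "real^'d^'d \<Rightarrow> bool" where
  "pos_def A \<longleftrightarrow> transpose A = A \<and> (\<forall>v. v \<noteq> 0 \<longrightarrow> v \<bullet> (A *v v) > 0)"

definition gauss_density :: "real^'d \<Rightarrow> real^'d^'d \<Rightarrow> real^'d \<Rightarrow> real" where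
  "gauss_density b A x =
     1 / (sqrt (2 * pi) ^ CARD('d) * sqrt (det A))
       * exp (- (1/2) * ((x - b) \<bullet> (matrix_inv A *v (x - b))))"

definition gauss_mixture ::
    "nat \<Rightarrow> (nat \<Rightarrow> real) \<Rightarrow> (nat \<Rightarrow> real^'d) \<Rightarrow> (nat \<Rightarrow> real^'d^'d) \<Rightarrow> real^'d \<Rightarrow> real" where
  "gauss_mixture M c b A x = (\<Sum>k=1..M. c k * gauss_density (b k) (A k) x)"

definition lambda_coef :: "real \<Rightarrow> real" where
  "lambda_coef t = exp (- t)"

definition sigma_coef :: "real \<Rightarrow> real" where
  "sigma_coef t = sqrt (1 - exp (- 2 * t))"

(* A Lebesgue density is only determined almost everywhere; pointwise statements about
   a density and its derivatives refer to the continuous version, which is unique. *)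
definition has_continuous_density ::
    "'p measure \<Rightarrow> ('p \<Rightarrow> real^'d) \<Rightarrow> (real^'d \<Rightarrow> real) \<Rightarrow> bool" where
  "has_continuous_density P X f \<longleftrightarrow>
     distributed P lborel X (\<lambda>x. ennreal (f x)) \<and> continuous_on UNIV f \<and> (\<forall>x. 0 \<le> f x)"

definition partial_deriv :: "'d \<Rightarrow> (real^'d \<Rightarrow> real) \<Rightarrow> real^'d \<Rightarrow> real" where
  "partial_deriv i f x = deriv (\<lambda>s. f (x + s *\<^sub>R axis i 1)) 0"

(* A multi-index is a function on the coordinate index type 'd.  Since 'd carries no order,
   the list xs names the coordinates x_1, ..., x_d, and the derivative is
   (d/dx_1)^(alpha_1) ... (d/dx_d)^(alpha_d) f, with x_d applied first. *)
definition multi_deriv ::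
    "'d list \<Rightarrow> ('d \<Rightarrow> nat) \<Rightarrow> (real^'d \<Rightarrow> real) \<Rightarrow> real^'d \<Rightarrow> real" where
  "multi_deriv xs \<alpha> f = foldr (\<lambda>i. partial_deriv i ^^ \<alpha> i) xs f"

end

theory Submission
  imports Defs
begin

text \<open>Convolving each Gaussian component with the noise and completing the square shows that
  \<open>q\<^sub>t(x) = \<Sum>\<^sub>k K\<^sub>k exp (- (x - \<lambda> b\<^sub>k) \<bullet> B\<^sub>k\<inverse> (x - \<lambda> b\<^sub>k) / 2)\<close> with
  \<open>B\<^sub>k = \<lambda>\<^sup>2 A\<^sub>k + \<sigma>\<^sup>2 I\<close> and some constants \<open>K\<^sub>k \<ge> 0\<close>; the normalisation of the Gaussians is
  irrelevant for the quotient and never computed. As \<open>\<lambda>\<^sup>2 + \<sigma>\<^sup>2 = 1\<close>, the matrices \<open>B\<^sub>k\<inverse>\<close> are bounded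
  uniformly in \<open>t\<close>, so a derivative of order \<open>n\<close> multiplies each summand by a polynomial of degree \<open>n\<close>
  whose coefficients are bounded uniformly in \<open>t\<close> and \<open>k\<close>. The bound on these factors passes to
  the sum because all summands are nonnegative.\<close>

section \<open>Positive definite matrices\<close>

lemma pos_def_invertible:
  assumes "pos_def A"
  shows "invertible A"
  unfolding invertible_left_inverse matrix_left_invertible_ker
  using assms by (metis inner_zero_right less_irrefl pos_def_def)

lemma matrix_inv_cancel:
  fixes A :: "real^'n^'n"
  assumes "invertible A"
  shows "A *v (matrix_inv A *v x) = x" "matrix_inv A *v (A *v x) = x"
proof -
  have "A ** matrix_inv A = mat 1 \<and> matrix_inv A ** A = mat 1"
    unfolding matrix_inv_def using assms unfolding invertible_def by (rule someI_ex)
  then show "A *v (matrix_inv A *v x) = x" "matrix_inv A *v (A *v x) = x"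
    by (simp_all add: matrix_vector_mul_assoc)
qed

lemma symmetric_matrix_inner:
  fixes A :: "real^'n^'n"
  assumes "transpose A = A"
  shows "x \<bullet> (A *v y) = (A *v x) \<bullet> y"
  using assms by (metis dot_lmul_matrix vector_transpose_matrix)

lemma pos_def_inv_symmetric:
  assumes "pos_def A"
  shows "x \<bullet> (matrix_inv A *v y) = (matrix_inv A *v x) \<bullet> y"
  by (metis assms matrix_inv_cancel(1) pos_def_def pos_def_invertible symmetric_matrix_inner)

text \<open>By compactness the quadratic form attains a minimum on the unit sphere, positive by
  definiteness. Homogeneity of degree two carries the bound over to all vectors.\<close>

lemma pos_def_coercive:
  fixes A :: "real^'n^'n"
  assumes "pos_def A"
  obtains m where "0 < m" "\<And>v. m * (v \<bullet> v) \<le> v \<bullet> (A *v v)"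
proof -
  let ?S = "sphere (0 :: real^'n) 1"
  have "axis undefined 1 \<in> ?S"
    by (simp add: norm_axis_1)
  then have "?S \<noteq> {}" by blast
  moreover have "continuous_on ?S (\<lambda>v. v \<bullet> (A *v v))"
    by (intro continuous_intros matrix_vector_mult_linear_continuous_on)
  ultimately obtain u where u: "u \<in> ?S" "\<And>v. v \<in> ?S \<Longrightarrow> u \<bullet> (A *v u) \<le> v \<bullet> (A *v v)"
    using continuous_attains_inf[OF compact_sphere] by blast
  show thesis
  proof
    show "0 < u \<bullet> (A *v u)"
      using assms u(1) unfolding pos_def_def by (metis norm_zero mem_sphere_0 zero_neq_one)
    fix v :: "real^'n"
    show "u \<bullet> (A *v u) * (v \<bullet> v) \<le> v \<bullet> (A *v v)"
    proof (cases "v = 0")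
      case False
      have "u \<bullet> (A *v u) \<le> sgn v \<bullet> (A *v sgn v)"
        using u(2)[of "sgn v"] False by (simp add: norm_sgn)
      also have "\<dots> = (v \<bullet> (A *v v)) / (v \<bullet> v)"
        by (simp add: sgn_div_norm matrix_vector_mult_scaleR dot_square_norm power2_eq_square field_simps)
      finally show ?thesis
        using False by (simp add: pos_le_divide_eq)
    qed simp
  qed
qed

text \<open>Otherwise, by the intermediate value theorem, some matrix on the segment from the
  identity to \<open>A\<close> would be singular. But every such convex combination has a positive
  quadratic form and hence a trivial kernel.\<close>

lemma pos_def_det_pos:
  fixes A :: "real^'n^'n"
  assumes "pos_def A"
  shows "0 < det A"
proof (rule ccontr)
  define B where "B s = (1 - s) *\<^sub>R mat 1 + s *\<^sub>R A" for s :: real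
  assume "\<not> 0 < det A"
  then have "det (B 1) \<le> 0"
    by (simp add: B_def)
  moreover have "0 \<le> det (B 0)"
    by (simp add: B_def)
  moreover have "continuous_on {0..1} (\<lambda>s. det (B s))"
    unfolding det_def B_def by (intro continuous_intros)
  ultimately obtain s where s: "0 \<le> s" "s \<le> 1" "det (B s) = 0"
    using IVT2'[of "\<lambda>s. det (B s)" 1 0 0] by auto
  then have "\<not> invertible (B s)"
    by (simp add: invertible_det_nz)
  then obtain v where v: "B s *v v = 0" "v \<noteq> 0"
    unfolding invertible_left_inverse matrix_left_invertible_ker by blast
  have "v \<bullet> (B s *v v) = (1 - s) * (v \<bullet> v) + s * (v \<bullet> (A *v v))"
    unfolding B_def
    by (simp add: matrix_vector_mult_add_rdistrib inner_add_right flip: scaleR_matrix_vector_assoc)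
  moreover have "0 < (1 - s) * (v \<bullet> v) + s * (v \<bullet> (A *v v))"
  proof (cases "s = 0")
    case False
    then show ?thesis
      using assms v(2) s unfolding pos_def_def
      by (intro add_nonneg_pos mult_nonneg_nonneg mult_pos_pos) auto
  qed (use v in auto)
  ultimately show False
    using v by simp
qed

section \<open>The noised covariance\<close>

lemma coef_bounds:
  assumes "0 \<le> t"
  shows "0 < lambda_coef t" "lambda_coef t \<le> 1"
    "(lambda_coef t)\<^sup>2 + (sigma_coef t)\<^sup>2 = 1"
  using assms by (simp_all add: lambda_coef_def sigma_coef_def flip: exp_of_nat_mult exp_double)

text \<open>The covariance of \<open>\<lambda> X + \<sigma> W\<close> for independent \<open>X\<close>, \<open>W\<close> with covariances \<open>A\<close> and the identity.\<close>

definition noised_cov :: "real^'n^'n \<Rightarrow> real \<Rightarrow> real^'n^'n" where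
  "noised_cov A t = (lambda_coef t)\<^sup>2 *\<^sub>R A + (sigma_coef t)\<^sup>2 *\<^sub>R mat 1"

lemma noised_cov_mult:
  "noised_cov A t *v v = (lambda_coef t)\<^sup>2 *\<^sub>R (A *v v) + (sigma_coef t)\<^sup>2 *\<^sub>R v"
  by (simp add: noised_cov_def matrix_vector_mult_add_rdistrib flip: scaleR_matrix_vector_assoc)

text \<open>Since the squared coefficients sum to 1, the noised covariance is a convex combination
  of \<open>A\<close> and the identity. The identity satisfies the bound because
  \<open>m \<le> 1\<close>, so the same \<open>m\<close> serves all times.\<close>

lemma noised_cov_coercive:
  assumes "0 \<le> t" "m \<le> 1" "m * (v \<bullet> v) \<le> v \<bullet> (A *v v)"
  shows "m * (v \<bullet> v) \<le> v \<bullet> (noised_cov A t *v v)"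
proof -
  let ?l = "(lambda_coef t)\<^sup>2" and ?s = "(sigma_coef t)\<^sup>2"
  have "m * (v \<bullet> v) = ?l * (m * (v \<bullet> v)) + ?s * (m * (v \<bullet> v))"
    using coef_bounds(3)[OF assms(1)] by (metis distrib_right mult_1)
  also have "\<dots> \<le> ?l * (v \<bullet> (A *v v)) + ?s * (v \<bullet> v)"
    using assms mult_right_mono[of m 1 "v \<bullet> v"] by (intro add_mono mult_left_mono) auto
  finally show ?thesis
    by (simp add: noised_cov_mult inner_add_right)
qed

lemma pos_def_noised_cov:
  assumes "pos_def A" "0 \<le> t"
  shows "pos_def (noised_cov A t)"
proof -
  obtain m where m: "0 < m" "\<And>v. m * (v \<bullet> v) \<le> v \<bullet> (A *v v)"
    using pos_def_coercive[OF assms(1)] by blast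
  have "transpose (noised_cov A t) = noised_cov A t"
    using assms(1) by (simp add: pos_def_def noised_cov_def transpose_def vec_eq_iff mat_def)
  moreover have "0 < v \<bullet> (noised_cov A t *v v)" if "v \<noteq> 0" for v
  proof -
    have "min m 1 * (v \<bullet> v) \<le> v \<bullet> (noised_cov A t *v v)"
      using m(2)[of v] mult_right_mono[of "min m 1" m "v \<bullet> v"] by (intro noised_cov_coercive assms) auto
    moreover have "0 < min m 1 * (v \<bullet> v)"
      using m(1) that by simp
    ultimately show ?thesis by linarith
  qed
  ultimately show ?thesis
    by (simp add: pos_def_def)
qed

text \<open>This is the source of uniformity in time: \<open>h\<close> is obtained before
  \<open>t\<close>. For \<open>w\<close> the image of \<open>v\<close> under the inverse, coercivity
  and Cauchy-Schwarz give m |w|^2 <= w . v <= |w| |v|.\<close>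

lemma noised_precision_bound:
  assumes "pos_def A"
  obtains h where "1 \<le> h" "\<And>t v. 0 \<le> t \<Longrightarrow> norm (matrix_inv (noised_cov A t) *v v) \<le> h * norm v"
proof -
  obtain m0 where m0: "0 < m0" "\<And>v. m0 * (v \<bullet> v) \<le> v \<bullet> (A *v v)"
    using pos_def_coercive[OF assms] by blast
  \<comment> \<open>Truncation at 1 makes the constant valid for the identity matrix as
    well.\<close>
  define m where "m = min m0 1"
  have m: "0 < m" "m \<le> 1"
    using m0 by (auto simp: m_def)
  have m3: "m * (v \<bullet> v) \<le> v \<bullet> (A *v v)" for v
    using m0(2)[of v] mult_right_mono[of m m0 "v \<bullet> v"] by (simp add: m_def)
  show thesis
  proof
    show "1 \<le> 1 / m" using m by simp
    fix t :: real and v assume t: "0 \<le> t"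
    define w where "w = matrix_inv (noised_cov A t) *v v"
    have w: "noised_cov A t *v w = v"
      unfolding w_def by (intro matrix_inv_cancel pos_def_invertible pos_def_noised_cov assms t)
    have "m * (norm w * norm w) \<le> w \<bullet> v"
      using noised_cov_coercive[OF t m(2) m3, of w] by (simp add: w dot_square_norm power2_eq_square)
    also have "\<dots> \<le> norm w * norm v"
      by (rule norm_cauchy_schwarz)
    finally have "norm w * (m * norm w) \<le> norm w * norm v"
      by (simp add: mult_ac)
    then have "m * norm w \<le> norm v"
      by (cases "w = 0") auto
    then show "norm (matrix_inv (noised_cov A t) *v v) \<le> 1 / m * norm v"
      using m by (simp add: w_def field_simps)
  qed
qed

text \<open>The exponent of component times noise is quadratic in the integration variable and
  minimal at \<open>lambda_coef t *\<^sub>R (A *v h)\<close>. Expanding about this point removes the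
  terms linear in \<open>y\<close>, so the contributions of \<open>u\<close> and \<open>y\<close>
  separate.\<close>

lemma complete_square:
  fixes A :: "real^'n^'n"
  assumes A: "pos_def A" and t: "0 \<le> t" and s: "sigma_coef t \<noteq> 0"
    and h: "noised_cov A t *v h = u"
  shows "(lambda_coef t *\<^sub>R (A *v h) + y) \<bullet> (matrix_inv A *v (lambda_coef t *\<^sub>R (A *v h) + y))
      + (norm (u - lambda_coef t *\<^sub>R (lambda_coef t *\<^sub>R (A *v h) + y)))\<^sup>2 / (sigma_coef t)\<^sup>2
    = u \<bullet> h + (y \<bullet> (matrix_inv A *v y) + (lambda_coef t)\<^sup>2 * (y \<bullet> y) / (sigma_coef t)\<^sup>2)"
proof -
  let ?l = "lambda_coef t" and ?s = "sigma_coef t"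
  have u: "u = ?l\<^sup>2 *\<^sub>R (A *v h) + ?s\<^sup>2 *\<^sub>R h"
    using h by (simp add: noised_cov_mult)
  have Sh: "matrix_inv A *v (A *v h) = h"
    by (intro matrix_inv_cancel pos_def_invertible A)
  have *: "(A *v h) \<bullet> (matrix_inv A *v y) = h \<bullet> y"
    using pos_def_inv_symmetric[OF A] Sh by metis
  have "u - ?l *\<^sub>R (?l *\<^sub>R (A *v h) + y) = ?s\<^sup>2 *\<^sub>R h - ?l *\<^sub>R y"
    by (simp add: u scaleR_add_right power2_eq_square)
  then have "(norm (u - ?l *\<^sub>R (?l *\<^sub>R (A *v h) + y)))\<^sup>2
      = ?s\<^sup>2 * ?s\<^sup>2 * (h \<bullet> h) - 2 * ?l * ?s\<^sup>2 * (h \<bullet> y) + ?l\<^sup>2 * (y \<bullet> y)"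
    unfolding power2_norm_eq_inner
    by (simp add: inner_diff_left inner_diff_right inner_commute[of y h] power2_eq_square)
      (simp add: algebra_simps)
  then have "(norm (u - ?l *\<^sub>R (?l *\<^sub>R (A *v h) + y)))\<^sup>2 / ?s\<^sup>2
      = ?s\<^sup>2 * (h \<bullet> h) - 2 * ?l * (h \<bullet> y) + ?l\<^sup>2 * (y \<bullet> y) / ?s\<^sup>2"
    using s by (simp add: field_simps power2_eq_square)
  \<comment> \<open>The mixed term in \<open>h \<bullet> y\<close> is opposite to the one in the
    noise part, so both cancel in the sum.\<close>
  moreover have "(?l *\<^sub>R (A *v h) + y) \<bullet> (matrix_inv A *v (?l *\<^sub>R (A *v h) + y))
      = ?l\<^sup>2 * ((A *v h) \<bullet> h) + 2 * ?l * (h \<bullet> y) + y \<bullet> (matrix_inv A *v y)"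
    by (simp add: matrix_vector_right_distrib matrix_vector_mult_scaleR Sh * inner_add_left
        inner_add_right inner_commute[of y h] power2_eq_square)
      (simp add: algebra_simps)
  moreover have "u \<bullet> h = ?l\<^sup>2 * ((A *v h) \<bullet> h) + ?s\<^sup>2 * (h \<bullet> h)"
    by (simp add: u inner_add_left)
  ultimately show ?thesis
    by simp
qed

section \<open>Iterated partial derivatives of Gaussian sums\<close>

text \<open>The value of \<open>deriv\<close> carries no information without differentiability.
  Recording existence and value together, at every point, lets the rules compose and the derivative
  be differentiated again.\<close>

definition has_partial :: "'n \<Rightarrow> (real^'n \<Rightarrow> real) \<Rightarrow> (real^'n \<Rightarrow> real) \<Rightarrow> bool" where
  "has_partial i f f' \<longleftrightarrow> (\<forall>x. ((\<lambda>s. f (x + s *\<^sub>R axis i 1)) has_real_derivative f' x) (at 0))"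

lemma partial_deriv_eq: "has_partial i f f' \<Longrightarrow> partial_deriv i f = f'"
  unfolding has_partial_def partial_deriv_def by (auto intro: DERIV_imp_deriv)

lemma has_partial_const: "has_partial i (\<lambda>x. a) (\<lambda>x. 0)"
  by (simp add: has_partial_def)

lemma has_partial_add:
  "has_partial i f f' \<Longrightarrow> has_partial i g g' \<Longrightarrow> has_partial i (\<lambda>x. f x + g x) (\<lambda>x. f' x + g' x)"
  unfolding has_partial_def by (auto intro: DERIV_add)

lemma has_partial_sum:
  "(\<And>k. k \<in> I \<Longrightarrow> has_partial i (f k) (f' k)) \<Longrightarrow>
    has_partial i (\<lambda>x. \<Sum>k\<in>I. f k x) (\<lambda>x. \<Sum>k\<in>I. f' k x)"
  unfolding has_partial_def by (auto intro!: DERIV_sum)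

lemma has_partial_mult:
  assumes "has_partial i f f'" "has_partial i g g'"
  shows "has_partial i (\<lambda>x. f x * g x) (\<lambda>x. f' x * g x + f x * g' x)"
  unfolding has_partial_def
proof
  fix x
  show "((\<lambda>s. f (x + s *\<^sub>R axis i 1) * g (x + s *\<^sub>R axis i 1)) has_real_derivative
      f' x * g x + f x * g' x) (at 0)"
    using DERIV_mult[of "\<lambda>s. f (x + s *\<^sub>R axis i 1)" "f' x" 0 UNIV
        "\<lambda>s. g (x + s *\<^sub>R axis i 1)" "g' x"] assms
    unfolding has_partial_def by (simp add: algebra_simps)
qed

lemma has_partial_affine: "has_partial i (\<lambda>x. v \<bullet> x + r) (\<lambda>x. v $ i)"
  unfolding has_partial_def
proof
  fix x
  show "((\<lambda>s. v \<bullet> (x + s *\<^sub>R axis i 1) + r) has_real_derivative v $ i) (at 0)"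
    by (auto intro!: derivative_eq_intros simp: inner_add_right inner_axis)
qed

text \<open>The logarithmic derivative of a Gaussian is affine; symmetry of \<open>H\<close> merges
  the two linear terms of the form. Linear and constant parts are kept apart to fit the rule
  \<open>affine\<close> of \<open>bounded_poly\<close>.\<close>

lemma has_partial_exp_quadratic:
  fixes H :: "real^'n^'n"
  assumes "\<And>x y. x \<bullet> (H *v y) = (H *v x) \<bullet> y"
  shows "has_partial i (\<lambda>x. K * exp (- (1/2) * ((x - m) \<bullet> (H *v (x - m)))))
    (\<lambda>x. (- (H *v axis i 1) \<bullet> x + (H *v axis i 1) \<bullet> m) *
       (K * exp (- (1/2) * ((x - m) \<bullet> (H *v (x - m))))))"
  unfolding has_partial_def
proof
  fix x
  let ?e = "axis i 1 :: real^'n"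
  \<comment> \<open>On a coordinate line the form is a quadratic polynomial in \<open>s\<close>;
    only its linear coefficient contributes to the derivative at 0.\<close>
  have expand: "(x + s *\<^sub>R ?e - m) \<bullet> (H *v (x + s *\<^sub>R ?e - m)) =
     (x - m) \<bullet> (H *v (x - m)) + 2 * s * ((H *v ?e) \<bullet> (x - m)) + s * s * (?e \<bullet> (H *v ?e))" for s
  proof -
    have "x + s *\<^sub>R ?e - m = (x - m) + s *\<^sub>R ?e" by simp
    moreover have "(x - m) \<bullet> (H *v ?e) = (H *v ?e) \<bullet> (x - m)"
      "?e \<bullet> (H *v (x - m)) = (H *v ?e) \<bullet> (x - m)"
      by (rule inner_commute, rule assms)
    ultimately show ?thesis
      by (simp only: matrix_vector_right_distrib matrix_vector_mult_scaleR inner_add_left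
          inner_add_right inner_scaleR_left inner_scaleR_right) (simp add: algebra_simps)
  qed
  show "((\<lambda>s. K * exp (- (1/2) * ((x + s *\<^sub>R ?e - m) \<bullet> (H *v (x + s *\<^sub>R ?e - m)))))
     has_real_derivative (- (H *v ?e) \<bullet> x + (H *v ?e) \<bullet> m) *
       (K * exp (- (1/2) * ((x - m) \<bullet> (H *v (x - m)))))) (at 0)"
    unfolding expand
    by (auto intro!: derivative_eq_intros simp: inner_diff_right algebra_simps)
qed

text \<open>Polynomials of degree at most \<open>n\<close> given as sums of products of affine functions with
  coefficients bounded by \<open>L\<close>; the weight \<open>c\<close> bounds the sum of the constant factors. Keeping
  \<open>n\<close>, \<open>L\<close>, \<open>c\<close> explicit makes the final estimate uniform in time and in the mixture weights.\<close>

inductive bounded_poly :: "real \<Rightarrow> nat \<Rightarrow> real \<Rightarrow> (real^'n \<Rightarrow> real) \<Rightarrow> bool" for L where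
  const: "\<bar>a\<bar> \<le> c \<Longrightarrow> bounded_poly L n c (\<lambda>x. a)"
| affine: "bounded_poly L n c p \<Longrightarrow> norm v \<le> L \<Longrightarrow> \<bar>r\<bar> \<le> L \<Longrightarrow>
    bounded_poly L (Suc n) c (\<lambda>x. (v \<bullet> x + r) * p x)"
| add: "bounded_poly L n c p \<Longrightarrow> bounded_poly L n c' p' \<Longrightarrow>
    bounded_poly L n (c + c') (\<lambda>x. p x + p' x)"

section \<open>Algebra, growth and differentiation of bounded polynomials\<close>

lemma bounded_poly_Suc: "bounded_poly L n c p \<Longrightarrow> bounded_poly L (Suc n) c p"
  by (induction rule: bounded_poly.induct) (auto intro: bounded_poly.intros)

lemma bounded_poly_cmult: "bounded_poly L n c p \<Longrightarrow> bounded_poly L n (\<bar>a\<bar> * c) (\<lambda>x. a * p x)"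
proof (induction rule: bounded_poly.induct)
  case (const r c n)
  then show ?case
    by (auto intro!: bounded_poly.const mult_left_mono simp: abs_mult)
next
  case (affine n c p v r)
  then show ?case
    using bounded_poly.affine[of L n "\<bar>a\<bar> * c" "\<lambda>x. a * p x" v r] by (simp add: mult_ac)
next
  case (add n c p c' p')
  then show ?case
    using bounded_poly.add by (simp add: distrib_left)
qed

lemma bounded_poly_nonneg: "bounded_poly L n c p \<Longrightarrow> 0 \<le> c"
  by (induction rule: bounded_poly.induct) auto

text \<open>The slack is absorbed by adding the constant 0 with weight
  \<open>c' - c\<close>.\<close>

lemma bounded_poly_mono:
  assumes "bounded_poly L n c p" "c \<le> c'"
  shows "bounded_poly L n c' p"
  using bounded_poly.add[OF assms(1) bounded_poly.const[of 0 "c' - c"]] assms(2) by simp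

text \<open>Each affine factor is at most L (1 + |x|). As \<open>1 \<le> L\<close>, this quantity is
  at least 1, which covers products with fewer than \<open>n\<close> factors.\<close>

lemma bounded_poly_abs_le:
  assumes "bounded_poly L n c p" "1 \<le> L"
  shows "\<bar>p x\<bar> \<le> c * (L * (1 + norm x)) ^ n"
  using assms(1)
proof (induction rule: bounded_poly.induct)
  case (const a c n)
  have "1 * 1 \<le> L * (1 + norm x)"
    using assms(2) by (intro mult_mono) auto
  then have "c * 1 \<le> c * (L * (1 + norm x)) ^ n"
    using const by (intro mult_left_mono one_le_power) auto
  then show ?case using const by simp
next
  case (affine n c p v r)
  have "\<bar>v \<bullet> x + r\<bar> \<le> norm v * norm x + \<bar>r\<bar>"
    using Cauchy_Schwarz_ineq2[of v x] by linarith
  also have "\<dots> \<le> L * norm x + L"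
    using affine by (intro add_mono mult_right_mono) auto
  finally have "\<bar>v \<bullet> x + r\<bar> \<le> L * (1 + norm x)"
    by (simp add: algebra_simps)
  then have "\<bar>v \<bullet> x + r\<bar> * \<bar>p x\<bar> \<le> (L * (1 + norm x)) * (c * (L * (1 + norm x)) ^ n)"
    using affine.IH assms(2) by (intro mult_mono) auto
  then show ?case
    by (simp add: abs_mult mult_ac)
next
  case (add n c p c' p')
  then show ?case
    by (simp add: distrib_right)
qed

text \<open>The product rule hits each of at most \<open>n\<close> affine factors once and replaces
  it by a number of modulus at most \<open>L\<close>, whence the factor
  \<open>n * L\<close>.\<close>

lemma bounded_poly_has_partial:
  assumes "bounded_poly L n c p" "0 \<le> L"
  shows "\<exists>p'. has_partial i p p' \<and> bounded_poly L n (n * L * c) p'"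
  using assms(1)
proof (induction rule: bounded_poly.induct)
  case (const a c n)
  then show ?case
    using assms(2) by (intro exI[of _ "\<lambda>x. 0"]) (auto intro: has_partial_const bounded_poly.const)
next
  case (affine n c p v r)
  then obtain p' where p': "has_partial i p p'" "bounded_poly L n (n * L * c) p'"
    by blast
  have "\<bar>v $ i\<bar> \<le> L"
    using component_le_norm_cart[of v i] affine by linarith
  then have "\<bar>v $ i\<bar> * c \<le> L * c"
    using bounded_poly_nonneg[OF affine.hyps(1)] by (rule mult_right_mono)
  \<comment> \<open>The nominal degree is raised so that both terms of the product rule can be
    added.\<close>
  then have "bounded_poly L (Suc n) (L * c) (\<lambda>x. v $ i * p x)"
    using affine.hyps bounded_poly_Suc bounded_poly_cmult bounded_poly_mono by blast
  moreover have "bounded_poly L (Suc n) (n * L * c) (\<lambda>x. (v \<bullet> x + r) * p' x)"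
    using p' affine.hyps by (intro bounded_poly.affine)
  ultimately have "bounded_poly L (Suc n) (L * c + n * L * c) (\<lambda>x. v $ i * p x + (v \<bullet> x + r) * p' x)"
    by (rule bounded_poly.add)
  moreover have "L * c + n * L * c = Suc n * L * c"
    by (simp add: algebra_simps)
  ultimately show ?case
    using has_partial_mult[OF has_partial_affine p'(1)] by metis
next
  case (add n c p c' q)
  then obtain p' q' where "has_partial i p p'" "bounded_poly L n (n * L * c) p'"
    "has_partial i q q'" "bounded_poly L n (n * L * c') q'"
    by blast
  then have "has_partial i (\<lambda>x. p x + q x) (\<lambda>x. p' x + q' x)"
    "bounded_poly L n (n * L * c + n * L * c') (\<lambda>x. p' x + q' x)"
    using bounded_poly.add has_partial_add by blast+
  then show ?case
    by (auto simp: distrib_left)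
qed

text \<open>A multi-index unfolds into a list of single coordinates whose length is its order, so
  induction over lists suffices. The order of differentiation is preserved, so no commutation of
  derivatives enters.\<close>

lemma foldr_funpow_eq_foldr:
  "\<exists>ys. length ys = sum_list (map \<alpha> xs) \<and> foldr (\<lambda>i. g i ^^ \<alpha> i) xs f = foldr g ys f"
proof (induction xs)
  case (Cons x xs)
  then obtain ys where "length ys = sum_list (map \<alpha> xs)"
    "foldr (\<lambda>i. g i ^^ \<alpha> i) xs f = foldr g ys f"
    by blast
  moreover have "(g x ^^ n) h = foldr g (replicate n x) h" for n h
    by (induction n) auto
  ultimately show ?case
    by (intro exI[of _ "replicate (\<alpha> x) x @ ys"]) simp
qed simp

text \<open>One more derivative contributes \<open>n * L\<close> by differentiating the polynomial
  factor and 1 by multiplying it with the affine logarithmic derivative.\<close>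

fun deriv_weight :: "real \<Rightarrow> nat \<Rightarrow> real" where
  "deriv_weight L 0 = 1"
| "deriv_weight L (Suc n) = (n * L + 1) * deriv_weight L n"

lemma deriv_weight_ge_1: "0 \<le> L \<Longrightarrow> 1 \<le> deriv_weight L n"
proof (induction n)
  case (Suc n)
  then have "1 * 1 \<le> (n * L + 1) * deriv_weight L n"
    by (intro mult_mono) auto
  then show ?case by simp
qed simp

lemma deriv_weight_mono:
  assumes "0 \<le> L" "m \<le> n"
  shows "deriv_weight L m \<le> deriv_weight L n"
  using assms(2)
proof (induction n rule: dec_induct)
  case (step n)
  have "1 * deriv_weight L n \<le> (n * L + 1) * deriv_weight L n"
    using assms deriv_weight_ge_1[of L n] by (intro mult_right_mono) auto
  then show ?case using step by simp
qed simp

text \<open>This separates the derivative estimate from time and probability: the bounds below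
  depend on the Gaussian data through \<open>L\<close> alone, so an \<open>L\<close> free of
  \<open>t\<close> yields a uniform bound.\<close>

locale gaussian_sum =
  fixes L :: real and I :: "'k set" and H :: "'k \<Rightarrow> real^'n^'n" and m :: "'k \<Rightarrow> real^'n"
    and K :: "'k \<Rightarrow> real"
  assumes L: "1 \<le> L"
    and sym: "\<And>k x y. k \<in> I \<Longrightarrow> x \<bullet> (H k *v y) = (H k *v x) \<bullet> y"
    and coefs: "\<And>k i. k \<in> I \<Longrightarrow> norm (H k *v axis i 1) \<le> L"
      "\<And>k i. k \<in> I \<Longrightarrow> \<bar>(H k *v axis i 1) \<bullet> m k\<bar> \<le> L"
    and K: "\<And>k. k \<in> I \<Longrightarrow> 0 \<le> K k"
begin

definition gterm :: "'k \<Rightarrow> real^'n \<Rightarrow> real" where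
  "gterm k x = K k * exp (- (1/2) * ((x - m k) \<bullet> (H k *v (x - m k))))"

definition gsum :: "real^'n \<Rightarrow> real" where
  "gsum x = (\<Sum>k\<in>I. gterm k x)"

lemma gterm_nonneg: "k \<in> I \<Longrightarrow> 0 \<le> gterm k x"
  using K by (simp add: gterm_def)

text \<open>Each derivative reproduces the exponentials and turns the prefactor \<open>p\<close>
  into \<open>p'\<close> plus the affine factor times \<open>p\<close>, which raises the degree by
  one.\<close>

lemma iterated_partial_gsum:
  "\<exists>p. (\<forall>k\<in>I. bounded_poly L (length ys) (deriv_weight L (length ys)) (p k)) \<and>
     foldr partial_deriv ys gsum = (\<lambda>x. \<Sum>k\<in>I. p k x * gterm k x)"
proof (induction ys)
  case Nil
  show ?case
    by (rule exI[of _ "\<lambda>k x. 1"]) (auto simp: gsum_def intro: bounded_poly.const)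
next
  case (Cons i ys)
  let ?n = "length ys"
  define aff where "aff k x = - (H k *v axis i 1) \<bullet> x + (H k *v axis i 1) \<bullet> m k" for k x
  obtain p where p: "\<And>k. k \<in> I \<Longrightarrow> bounded_poly L ?n (deriv_weight L ?n) (p k)"
    "foldr partial_deriv ys gsum = (\<lambda>x. \<Sum>k\<in>I. p k x * gterm k x)"
    using Cons by blast
  have "\<forall>k\<in>I. \<exists>p'. has_partial i (p k) p' \<and> bounded_poly L ?n (?n * L * deriv_weight L ?n) p'"
    using p(1) L by (auto intro: bounded_poly_has_partial)
  then obtain p' where p': "\<And>k. k \<in> I \<Longrightarrow> has_partial i (p k) (p' k)"
    "\<And>k. k \<in> I \<Longrightarrow> bounded_poly L ?n (?n * L * deriv_weight L ?n) (p' k)"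
    by metis
  define q where "q k x = p' k x + aff k x * p k x" for k x
  have "has_partial i (\<lambda>x. p k x * gterm k x) (\<lambda>x. q k x * gterm k x)" if "k \<in> I" for k
  proof -
    have "has_partial i (gterm k) (\<lambda>x. aff k x * gterm k x)"
      unfolding gterm_def aff_def using sym[OF that] by (rule has_partial_exp_quadratic)
    from has_partial_mult[OF p'(1)[OF that] this] show ?thesis
      by (simp add: q_def algebra_simps)
  qed
  then have "foldr partial_deriv (i # ys) gsum = (\<lambda>x. \<Sum>k\<in>I. q k x * gterm k x)"
    using p(2) by (simp add: partial_deriv_eq has_partial_sum)
  moreover have "bounded_poly L (length (i # ys)) (deriv_weight L (length (i # ys))) (q k)"
    if "k \<in> I" for k
  proof -
    have "bounded_poly L (Suc ?n) (deriv_weight L ?n) (\<lambda>x. aff k x * p k x)"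
      unfolding aff_def using p(1) coefs that by (intro bounded_poly.affine) auto
    from bounded_poly.add[OF bounded_poly_Suc[OF p'(2)[OF that]] this] show ?thesis
      unfolding q_def by (simp add: algebra_simps)
  qed
  ultimately show ?case by blast
qed

text \<open>All prefactors share the bound \<open>?B\<close>. Since the summands are nonnegative,
  the numerator is at most \<open>?B * gsum x\<close>.\<close>

lemma multi_deriv_gsum_ratio:
  assumes "distinct xs" "set xs = UNIV" "(\<Sum>i\<in>UNIV. \<alpha> i) \<le> l"
  shows "\<bar>multi_deriv xs \<alpha> gsum x\<bar> / gsum x
    \<le> (deriv_weight L l * (2 * L) ^ l) * norm x ^ l + deriv_weight L l * (2 * L) ^ l"
proof -
  let ?B = "deriv_weight L l * (L * (1 + norm x)) ^ l"
  obtain ys where ys: "length ys = sum_list (map \<alpha> xs)"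
    "multi_deriv xs \<alpha> gsum = foldr partial_deriv ys gsum"
    unfolding multi_deriv_def using foldr_funpow_eq_foldr[of \<alpha> xs partial_deriv gsum] by blast
  have len: "length ys \<le> l"
    using assms ys(1) by (simp add: sum_list_distinct_conv_sum_set)
  obtain p where p: "\<And>k. k \<in> I \<Longrightarrow> bounded_poly L (length ys) (deriv_weight L (length ys)) (p k)"
    "multi_deriv xs \<alpha> gsum = (\<lambda>x. \<Sum>k\<in>I. p k x * gterm k x)"
    using iterated_partial_gsum[of ys] ys(2) by auto
  have B: "\<bar>p k x\<bar> \<le> ?B" if "k \<in> I" for k
  proof -
    have "1 * 1 \<le> L * (1 + norm x)"
      using L by (intro mult_mono) auto
    have "\<bar>p k x\<bar> \<le> deriv_weight L (length ys) * (L * (1 + norm x)) ^ length ys"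
      using bounded_poly_abs_le p(1)[OF that] L by blast
    \<comment> \<open>The order of the multi-index may be below \<open>l\<close>; both weight and
      power grow with the exponent because the base is at least 1.\<close>
    also have "\<dots> \<le> ?B"
      using L len \<open>1 * 1 \<le> _\<close> deriv_weight_ge_1[of L l]
      by (intro mult_mono deriv_weight_mono power_increasing) auto
    finally show ?thesis .
  qed
  have "\<bar>multi_deriv xs \<alpha> gsum x\<bar> \<le> (\<Sum>k\<in>I. \<bar>p k x * gterm k x\<bar>)"
    unfolding p(2) by (rule sum_abs)
  also have "\<dots> \<le> (\<Sum>k\<in>I. ?B * gterm k x)"
    using B gterm_nonneg by (intro sum_mono) (simp add: abs_mult mult_right_mono)
  finally have "\<bar>multi_deriv xs \<alpha> gsum x\<bar> \<le> ?B * gsum x"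
    by (simp add: gsum_def sum_distrib_left)
  moreover have "0 \<le> gsum x" "0 \<le> ?B"
    using L deriv_weight_ge_1[of L l] by (auto simp: gsum_def gterm_nonneg intro!: sum_nonneg)
  ultimately have "\<bar>multi_deriv xs \<alpha> gsum x\<bar> / gsum x \<le> ?B"
    \<comment> \<open>The locale lets all \<open>K k\<close> vanish; the quotient is then 0 by the
      convention for division by zero.\<close>
    by (cases "gsum x = 0") (auto simp: pos_divide_le_eq)
  also have "?B \<le> deriv_weight L l * (L ^ l * (2 ^ l * (norm x ^ l + 1)))"
  proof -
    have "(1 + norm x) ^ l \<le> (2 * max 1 (norm x)) ^ l"
      by (intro power_mono) auto
    moreover have "max 1 (norm x) ^ l \<le> norm x ^ l + 1"
      by (simp add: max_def)
    ultimately have "(1 + norm x) ^ l \<le> 2 ^ l * (norm x ^ l + 1)"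
      unfolding power_mult_distrib by (smt (verit) mult_left_mono zero_le_power)
    then show ?thesis
      using L deriv_weight_ge_1[of L l] unfolding power_mult_distrib
      by (intro mult_left_mono) auto
  qed
  finally show ?thesis
    by (simp add: power_mult_distrib algebra_simps)
qed

end

section \<open>The density of the noised mixture\<close>

lemma nn_integral_lborel_affine:
  fixes a :: "'a::euclidean_space" and f :: "'a \<Rightarrow> ennreal"
  assumes [measurable]: "f \<in> borel_measurable borel" and "0 < s"
  shows "(\<integral>\<^sup>+w. f (a + s *\<^sub>R w) \<partial>lborel) = (\<integral>\<^sup>+y. ennreal (1 / s ^ DIM('a)) * f y \<partial>lborel)"
proof -
  have "(\<integral>\<^sup>+y. f y \<partial>lborel) = ennreal (s ^ DIM('a)) * (\<integral>\<^sup>+w. f (a + s *\<^sub>R w) \<partial>lborel)"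
    using assms(2)
    by (subst lborel_affine[of s a]) (simp_all add: nn_integral_density nn_integral_distr nn_integral_cmult)
  moreover have "ennreal (1 / s ^ DIM('a)) * ennreal (s ^ DIM('a)) = 1"
    using assms(2) by (simp flip: ennreal_mult)
  ultimately show ?thesis
    by (simp add: nn_integral_cmult flip: mult.assoc)
qed

text \<open>By independence the joint density is a product. For fixed \<open>x\<close> the
  substitution y = l x + s w has the Jacobian factor \<open>1 / s ^ DIM('b)\<close>, and Tonelli
  exchanges the integrals.\<close>

lemma (in prob_space) distributed_add_scaleR:
  fixes X W :: "'a \<Rightarrow> 'b::euclidean_space"
  assumes X: "distributed M lborel X f" and W: "distributed M lborel W g"
    and indep: "indep_var borel X borel W" and s: "0 < s"
  shows "distributed M lborel (\<lambda>\<omega>. l *\<^sub>R X \<omega> + s *\<^sub>R W \<omega>)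
    (\<lambda>y. \<integral>\<^sup>+x. f x * (ennreal (1 / s ^ DIM('b)) * g ((y - l *\<^sub>R x) /\<^sub>R s)) \<partial>lborel)"
proof -
  have [measurable]: "f \<in> borel_measurable borel" "g \<in> borel_measurable borel"
    using distributed_borel_measurable[OF X] distributed_borel_measurable[OF W] by simp_all
  have [measurable]: "X \<in> borel_measurable M" "W \<in> borel_measurable M"
    using distributed_measurable[OF X] distributed_measurable[OF W] by simp_all
  \<comment> \<open>Independence is stated over \<open>borel\<close>, densities over
    \<open>lborel\<close>; the image measures agree because the measurable sets do.\<close>
  have "distr M (lborel \<Otimes>\<^sub>M lborel) (\<lambda>\<omega>. (X \<omega>, W \<omega>)) = distr M (borel \<Otimes>\<^sub>M borel) (\<lambda>\<omega>. (X \<omega>, W \<omega>))"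
    by (intro distr_cong sets_pair_measure_cong) auto
  moreover have "distr M lborel X = distr M borel X" "distr M lborel W = distr M borel W"
    by (intro distr_cong; simp)+
  ultimately have "distr M lborel X \<Otimes>\<^sub>M distr M lborel W = distr M (lborel \<Otimes>\<^sub>M lborel) (\<lambda>\<omega>. (X \<omega>, W \<omega>))"
    using indep by (simp add: indep_var_distribution_eq)
  then have joint: "distributed M (lborel \<Otimes>\<^sub>M lborel) (\<lambda>\<omega>. (X \<omega>, W \<omega>)) (\<lambda>(x, w). f x * g w)"
    by (intro distributed_joint_indep' X W sigma_finite_lborel)
  let ?d = "\<lambda>x y. f x * (ennreal (1 / s ^ DIM('b)) * g ((y - l *\<^sub>R x) /\<^sub>R s))"
  show ?thesis
    unfolding distributed_def
  proof (intro conjI measure_eqI)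
    fix B assume "B \<in> sets (distr M lborel (\<lambda>\<omega>. l *\<^sub>R X \<omega> + s *\<^sub>R W \<omega>))"
    then have [measurable]: "B \<in> sets borel" by simp
    have "emeasure (distr M lborel (\<lambda>\<omega>. l *\<^sub>R X \<omega> + s *\<^sub>R W \<omega>)) B
        = (\<integral>\<^sup>+\<omega>. indicator B (l *\<^sub>R X \<omega> + s *\<^sub>R W \<omega>) \<partial>M)"
      by (simp add: nn_integral_distr flip: nn_integral_indicator)
    also have "\<dots> = (\<integral>\<^sup>+z. (case z of (x, w) \<Rightarrow> f x * g w) *
        (case z of (x, w) \<Rightarrow> indicator B (l *\<^sub>R x + s *\<^sub>R w)) \<partial>(lborel \<Otimes>\<^sub>M lborel))"
      by (subst distributed_nn_integral[OF joint]) simp_all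
    also have "\<dots> = (\<integral>\<^sup>+x. \<integral>\<^sup>+w. f x * g w * indicator B (l *\<^sub>R x + s *\<^sub>R w) \<partial>lborel \<partial>lborel)"
      by (subst lborel.nn_integral_fst[symmetric]) simp_all
    also have "\<dots> = (\<integral>\<^sup>+x. \<integral>\<^sup>+y. ?d x y * indicator B y \<partial>lborel \<partial>lborel)"
    proof (rule nn_integral_cong)
      fix x
      show "(\<integral>\<^sup>+w. f x * g w * indicator B (l *\<^sub>R x + s *\<^sub>R w) \<partial>lborel)
          = (\<integral>\<^sup>+y. ?d x y * indicator B y \<partial>lborel)"
        using nn_integral_lborel_affine[of "\<lambda>y. f x * g ((y - l *\<^sub>R x) /\<^sub>R s) * indicator B y" s "l *\<^sub>R x"] s
        by (simp add: mult_ac)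
    qed
    also have "\<dots> = (\<integral>\<^sup>+y. \<integral>\<^sup>+x. ?d x y * indicator B y \<partial>lborel \<partial>lborel)"
      by (rule lborel_pair.Fubini') simp
    also have "\<dots> = (\<integral>\<^sup>+y. (\<integral>\<^sup>+x. ?d x y \<partial>lborel) * indicator B y \<partial>lborel)"
      by (intro nn_integral_cong nn_integral_multc) simp
    also have "\<dots> = emeasure (density lborel (\<lambda>y. \<integral>\<^sup>+x. ?d x y \<partial>lborel)) B"
      by (simp add: emeasure_density)
    finally show "emeasure (distr M lborel (\<lambda>\<omega>. l *\<^sub>R X \<omega> + s *\<^sub>R W \<omega>)) B =
        emeasure (density lborel (\<lambda>y. \<integral>\<^sup>+x. ?d x y \<partial>lborel)) B" .
  qed simp_all
qed

text \<open>The set of disagreement is open and null, hence empty. This turns almost everywhere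
  formulas for a density into pointwise ones that can be differentiated.\<close>

lemma continuous_AE_eq_imp_eq:
  fixes f g :: "'a::euclidean_space \<Rightarrow> 'b::t2_space"
  assumes "continuous_on UNIV f" "continuous_on UNIV g" "AE x in lborel. f x = g x"
  shows "f = g"
proof -
  have "open {x. f x \<noteq> g x}"
    using assms by (intro open_Collect_neq)
  moreover have "negligible {x. f x \<noteq> g x}"
  proof -
    have "{x. f x \<noteq> g x} \<in> null_sets lborel"
      using assms(3) \<open>open {x. f x \<noteq> g x}\<close> by (subst AE_iff_null_sets) auto
    then show ?thesis
      by (simp add: negligible_iff_null_sets null_sets_completionI)
  qed
  ultimately show ?thesis
    using open_not_negligible by blast
qed

section \<open>Gaussian components and their convolution with the noise\<close>

lemma continuous_on_gauss_density: "continuous_on UNIV (gauss_density b A)"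
  unfolding gauss_density_def
  by (intro continuous_intros
      continuous_on_compose2[OF matrix_vector_mult_linear_continuous_on]) auto

lemma gauss_density_nonneg: "pos_def A \<Longrightarrow> 0 \<le> gauss_density b A x"
  using pos_def_det_pos[of A] by (simp add: gauss_density_def)

text \<open>Writing the normalisation as the value at the mean avoids computing it.\<close>

lemma gauss_density_std:
  "gauss_density 0 (mat 1) x = gauss_density 0 (mat 1) (0 :: real^'n) * exp (- (1/2) * (norm x)\<^sup>2)" for x :: "real^'n"
proof -
  have "invertible (mat 1 :: real^'n^'n)"
    unfolding invertible_def by (rule exI[of _ "mat 1"]) simp
  from matrix_inv_cancel(1)[OF this] have "matrix_inv (mat 1) *v x = x" by simp
  then show ?thesis
    by (simp add: gauss_density_def power2_norm_eq_inner)
qed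

lemma gauss_density_shift:
  "gauss_density b A (b + z) = gauss_density b A b * exp (- (1/2) * (z \<bullet> (matrix_inv A *v z)))"
  by (simp add: gauss_density_def)

text \<open>After completing the square, \<open>y\<close> enters only through a factor that leaves
  the integral. The remaining integral is \<kappa>, an extended real whose finiteness is left open
  here.\<close>

lemma convolution_gauss_density:
  fixes A :: "real^'n^'n"
  assumes A: "pos_def A" and t: "0 \<le> t" and s: "sigma_coef t \<noteq> 0" and c: "0 \<le> c" "0 \<le> e"
  shows "\<exists>\<kappa>. \<forall>y. (\<integral>\<^sup>+x. ennreal (c * gauss_density b A x) *
       (ennreal e * ennreal (gauss_density 0 (mat 1) ((y - lambda_coef t *\<^sub>R x) /\<^sub>R sigma_coef t))) \<partial>lborel)
     = \<kappa> * ennreal (exp (- (1/2) * ((y - lambda_coef t *\<^sub>R b) \<bullet>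
         (matrix_inv (noised_cov A t) *v (y - lambda_coef t *\<^sub>R b)))))"
proof (intro exI allI)
  fix y
  let ?l = "lambda_coef t" and ?s = "sigma_coef t"
  let ?Q = "\<lambda>z. z \<bullet> (matrix_inv A *v z) + ?l\<^sup>2 * (z \<bullet> z) / ?s\<^sup>2"
  define u where "u = y - ?l *\<^sub>R b"
  define h where "h = matrix_inv (noised_cov A t) *v u"
  define N where "N = c * e * gauss_density b A b * gauss_density 0 (mat 1) (0::real^'n)"
  have "pos_def (mat 1 :: real^'n^'n)"
    by (simp add: pos_def_def)
  then have N: "0 \<le> N"
    unfolding N_def using A c by (intro mult_nonneg_nonneg gauss_density_nonneg)
  have h: "noised_cov A t *v h = u"
    unfolding h_def by (intro matrix_inv_cancel pos_def_invertible pos_def_noised_cov A t)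
  let ?f = "\<lambda>x. ennreal (c * gauss_density b A x) *
       (ennreal e * ennreal (gauss_density 0 (mat 1) ((y - ?l *\<^sub>R x) /\<^sub>R ?s)))"
  have f: "?f (b + z) = ennreal (N * exp (- (1/2) * (z \<bullet> (matrix_inv A *v z) + (norm (u - ?l *\<^sub>R z))\<^sup>2 / ?s\<^sup>2)))" for z
  proof -
    have "gauss_density 0 (mat 1) ((y - ?l *\<^sub>R (b + z)) /\<^sub>R ?s)
        = gauss_density 0 (mat 1) (0::real^'n) * exp (- (1/2) * ((norm (u - ?l *\<^sub>R z))\<^sup>2 / ?s\<^sup>2))"
    proof -
      have "y - ?l *\<^sub>R (b + z) = u - ?l *\<^sub>R z"
        by (simp add: u_def scaleR_add_right)
      moreover have "(norm ((u - ?l *\<^sub>R z) /\<^sub>R ?s))\<^sup>2 = (norm (u - ?l *\<^sub>R z))\<^sup>2 / ?s\<^sup>2"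
        by (simp add: power_mult_distrib divide_inverse power_inverse mult.commute)
      ultimately show ?thesis
        by (metis gauss_density_std)
    qed
    moreover have "0 \<le> gauss_density 0 (mat 1) (0::real^'n)" "0 \<le> gauss_density b A b"
      using A \<open>pos_def (mat 1)\<close> by (auto intro: gauss_density_nonneg)
    moreover have "exp (- (1/2) * (p + q)) = exp (- (1/2) * p) * exp (- (1/2) * q :: real)" for p q
      by (simp add: exp_add[symmetric] distrib_left)
    ultimately show ?thesis
      unfolding gauss_density_shift N_def using c by (simp add: mult_ac flip: ennreal_mult)
  qed
  have [measurable]: "gauss_density b A \<in> borel_measurable borel"
    "gauss_density 0 (mat 1 :: real^'n^'n) \<in> borel_measurable borel"
    by (intro borel_measurable_continuous_onI continuous_on_gauss_density)+
  have [measurable]: "?Q \<in> borel_measurable borel"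
    by (intro borel_measurable_continuous_onI continuous_intros matrix_vector_mult_linear_continuous_on)
      (use s in auto)
  \<comment> \<open>Translation invariance moves the origin to the minimiser of the
    exponent.\<close>
  have "(\<integral>\<^sup>+x. ?f x \<partial>lborel) = (\<integral>\<^sup>+z. ?f (b + (?l *\<^sub>R (A *v h) + z)) \<partial>lborel)"
    using nn_integral_lborel_affine[of ?f 1 "b + ?l *\<^sub>R (A *v h)"] by (simp add: add.assoc)
  also have "\<dots> = (\<integral>\<^sup>+z. ennreal (N * exp (- (1/2) * ?Q z)) * ennreal (exp (- (1/2) * (u \<bullet> h))) \<partial>lborel)"
  proof -
    have "exp (- (1/2) * (p + q)) = exp (- (1/2) * q) * exp (- (1/2) * p :: real)" for p q
      by (simp add: exp_add[symmetric] distrib_left add.commute)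
    then show ?thesis
      unfolding f complete_square[OF A t s h] using N
      by (simp only: mult.assoc ennreal_mult exp_ge_zero mult_nonneg_nonneg)
  qed
  also have "\<dots> = (\<integral>\<^sup>+z. ennreal (N * exp (- (1/2) * ?Q z)) \<partial>lborel) * ennreal (exp (- (1/2) * (u \<bullet> h)))"
    by (rule nn_integral_multc) simp
  \<comment> \<open>The witness \<kappa> is fixed here and must not involve \<open>y\<close> or
    names introduced after it, so \<open>N\<close> appears unfolded.\<close>
  finally show "(\<integral>\<^sup>+x. ?f x \<partial>lborel) =
      (\<integral>\<^sup>+z. ennreal (c * e * gauss_density b A b * gauss_density 0 (mat 1) (0::real^'n) * exp (- (1/2) * ?Q z)) \<partial>lborel) *
      ennreal (exp (- (1/2) * ((y - ?l *\<^sub>R b) \<bullet> (matrix_inv (noised_cov A t) *v (y - ?l *\<^sub>R b)))))"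
    by (simp only: N_def u_def h_def)
qed

text \<open>The convolution is linear in the mixture. Time 0 is treated apart, since the noise then
  vanishes and cannot be rescaled.\<close>

lemma noised_mixture_density:
  fixes A :: "nat \<Rightarrow> real^'n^'n" and b :: "nat \<Rightarrow> real^'n"
  assumes P: "prob_space P"
    and X: "distributed P lborel X (\<lambda>x. ennreal (gauss_mixture M c b A x))"
    and W: "distributed P lborel W (\<lambda>x. ennreal (gauss_density 0 (mat 1) x))"
    and indep: "prob_space.indep_var P borel X borel W"
    and q: "has_continuous_density P (\<lambda>\<omega>. lambda_coef t *\<^sub>R X \<omega> + sigma_coef t *\<^sub>R W \<omega>) q"
    and A: "\<And>k. k \<in> {1..M} \<Longrightarrow> pos_def (A k)" and c: "\<And>k. k \<in> {1..M} \<Longrightarrow> 0 < c k"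
    and t: "0 \<le> t"
  shows "\<exists>K. (\<forall>k\<in>{1..M}. 0 \<le> K k) \<and>
    q = (\<lambda>y. \<Sum>k=1..M. K k * exp (- (1/2) * ((y - lambda_coef t *\<^sub>R b k) \<bullet>
         (matrix_inv (noised_cov (A k) t) *v (y - lambda_coef t *\<^sub>R b k)))))"
proof -
  interpret prob_space P by (rule P)
  let ?l = "lambda_coef t" and ?s = "sigma_coef t"
  define G where "G k y = exp (- (1/2) * ((y - ?l *\<^sub>R b k) \<bullet>
      (matrix_inv (noised_cov (A k) t) *v (y - ?l *\<^sub>R b k))))" for k y
  have cont_G: "continuous_on UNIV (G k)" for k
    unfolding G_def
    by (intro continuous_intros continuous_on_compose2[OF matrix_vector_mult_linear_continuous_on]) auto
  have q': "distributed P lborel (\<lambda>\<omega>. ?l *\<^sub>R X \<omega> + ?s *\<^sub>R W \<omega>) (\<lambda>x. ennreal (q x))"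
    "continuous_on UNIV q" "\<And>x. 0 \<le> q x"
    using q by (auto simp: has_continuous_density_def)
  have gd: "0 \<le> c k * gauss_density (b k) (A k) x" if "k \<in> {1..M}" for k x
    using that by (intro mult_nonneg_nonneg gauss_density_nonneg A less_imp_le[OF c])
  have mix: "ennreal (gauss_mixture M c b A x) = (\<Sum>k=1..M. ennreal (c k * gauss_density (b k) (A k) x))" for x
    unfolding gauss_mixture_def by (rule sum_ennreal[symmetric]) (rule gd)
  have "\<exists>\<kappa>. AE y in lborel. ennreal (q y) = (\<Sum>k=1..M. \<kappa> k * ennreal (G k y))"
  proof (cases "t = 0")
    case True
    then have [simp]: "?l = 1" "?s = 0"
      by (simp_all add: lambda_coef_def sigma_coef_def)
    \<comment> \<open>At time 0 the noised covariance is \<open>A k\<close> itself.\<close>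
    have G: "gauss_density (b k) (A k) y = gauss_density (b k) (A k) (b k) * G k y" for k y
      using gauss_density_shift[of "b k" "A k" "y - b k"] by (simp add: G_def noised_cov_def)
    have "ennreal (gauss_mixture M c b A y)
        = (\<Sum>k=1..M. ennreal (c k * gauss_density (b k) (A k) (b k)) * ennreal (G k y))" for y
    proof -
      have "ennreal (c k * gauss_density (b k) (A k) y)
          = ennreal (c k * gauss_density (b k) (A k) (b k)) * ennreal (G k y)" if "k \<in> {1..M}" for k
        using ennreal_mult[OF gd[OF that, of "b k"], of "G k y"]
        by (metis G G_def exp_ge_zero mult.assoc)
      then show ?thesis
        unfolding mix by (rule sum.cong[OF refl])
    qed
    then have "AE y in lborel. ennreal (q y)
        = (\<Sum>k=1..M. ennreal (c k * gauss_density (b k) (A k) (b k)) * ennreal (G k y))"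
      using distributed_unique[OF q'(1), of "\<lambda>x. ennreal (gauss_mixture M c b A x)"] X by simp
    then show ?thesis
      by (rule exI[of _ "\<lambda>k. ennreal (c k * gauss_density (b k) (A k) (b k))"])
  next
    case False
    then have s: "0 < ?s"
      using t by (simp add: sigma_coef_def)
    let ?e = "1 / ?s ^ DIM(real^'n)"
    have "\<forall>k\<in>{1..M}. \<exists>\<kappa>. \<forall>y. (\<integral>\<^sup>+x. ennreal (c k * gauss_density (b k) (A k) x) *
       (ennreal ?e * ennreal (gauss_density 0 (mat 1) ((y - ?l *\<^sub>R x) /\<^sub>R ?s))) \<partial>lborel)
       = \<kappa> * ennreal (G k y)"
      unfolding G_def using A c s t by (intro ballI convolution_gauss_density) (auto intro: less_imp_le)
    from bchoice[OF this] obtain \<kappa> where \<kappa>: "\<forall>k\<in>{1..M}. \<forall>y. (\<integral>\<^sup>+x. ennreal (c k * gauss_density (b k) (A k) x) *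
       (ennreal ?e * ennreal (gauss_density 0 (mat 1) ((y - ?l *\<^sub>R x) /\<^sub>R ?s))) \<partial>lborel)
       = \<kappa> k * ennreal (G k y)" ..
    have [measurable]: "gauss_density v B \<in> borel_measurable borel" for v :: "real^'n" and B
      by (intro borel_measurable_continuous_onI continuous_on_gauss_density)
    have "(\<integral>\<^sup>+x. ennreal (gauss_mixture M c b A x) *
       (ennreal ?e * ennreal (gauss_density 0 (mat 1) ((y - ?l *\<^sub>R x) /\<^sub>R ?s))) \<partial>lborel)
       = (\<Sum>k=1..M. \<kappa> k * ennreal (G k y))" for y
      unfolding mix sum_distrib_right
      by (subst nn_integral_sum) (use \<kappa> in \<open>auto intro!: sum.cong\<close>)
    then have "AE y in lborel. ennreal (q y) = (\<Sum>k=1..M. \<kappa> k * ennreal (G k y))"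
      using distributed_unique[OF q'(1) distributed_add_scaleR[OF X W indep s]] by simp
    then show ?thesis
      by (rule exI[of _ \<kappa>])
  qed
  then obtain \<kappa> where ae: "AE y in lborel. ennreal (q y) = (\<Sum>k=1..M. \<kappa> k * ennreal (G k y))"
    by blast
  \<comment> \<open>The identity holds at some point, where the left side is finite; as
    \<open>G k y\<close> is positive there, every \<kappa> must be finite.\<close>
  have fin: "\<kappa> k < \<infinity>" if "k \<in> {1..M}" for k
  proof -
    have "ae_filter (lborel :: (real^'n) measure) \<noteq> bot"
      by (simp add: ae_filter_eq_bot_iff)
    then obtain y where "ennreal (q y) = (\<Sum>k=1..M. \<kappa> k * ennreal (G k y))"
      using eventually_happens'[OF _ ae] by blast
    then have "(\<Sum>k=1..M. \<kappa> k * ennreal (G k y)) < \<infinity>"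
      by (metis ennreal_less_top infinity_ennreal_def)
    then have "\<kappa> k * ennreal (G k y) < \<infinity>"
      using that member_le_sum[of k "{1..M}" "\<lambda>k. \<kappa> k * ennreal (G k y)"] by (auto intro: le_less_trans)
    then show ?thesis
      by (auto simp: G_def ennreal_mult_less_top)
  qed
  define K where "K k = enn2real (\<kappa> k)" for k
  have "AE y in lborel. q y = (\<Sum>k=1..M. K k * G k y)"
    using ae
  proof eventually_elim
    case (elim y)
    have "(\<Sum>k=1..M. \<kappa> k * ennreal (G k y)) = (\<Sum>k=1..M. ennreal (K k * G k y))"
      using fin by (intro sum.cong) (simp_all add: K_def G_def ennreal_mult)
    also have "\<dots> = ennreal (\<Sum>k=1..M. K k * G k y)"
      by (intro sum_ennreal) (simp add: K_def G_def)
    finally show ?case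
      using elim q'(3) by (simp add: K_def G_def sum_nonneg)
  qed
  then have "q = (\<lambda>y. \<Sum>k=1..M. K k * G k y)"
    by (intro continuous_AE_eq_imp_eq q' continuous_intros cont_G)
  then show ?thesis
    unfolding G_def by (intro exI[of _ K]) (simp add: K_def)
qed

section \<open>A constant uniform in time, evaluation point and mixture weights\<close>

theorem lemmaB5:
  fixes M l :: nat
    and A :: "nat \<Rightarrow> real^'d^'d"
    and b :: "nat \<Rightarrow> real^'d"
    and xs :: "'d list"
  assumes coords: "distinct xs" "set xs = UNIV"
    and pos: "\<And>k. k \<in> {1..M} \<Longrightarrow> pos_def (A k)"
    and ell: "1 \<le> l"
  shows "\<exists>C::real. \<forall>c :: nat \<Rightarrow> real.
    (\<forall>k\<in>{1..M}. 0 < c k) \<and> (\<Sum>k=1..M. c k) = 1 \<longrightarrow>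
    (\<forall>(P :: 'p measure) (X0 :: 'p \<Rightarrow> real^'d) (W :: 'p \<Rightarrow> real^'d) (q :: real \<Rightarrow> real^'d \<Rightarrow> real).
      prob_space P
      \<and> distributed P lborel X0 (\<lambda>x. ennreal (gauss_mixture M c b A x))
      \<and> distributed P lborel W (\<lambda>x. ennreal (gauss_density 0 (mat 1) x))
      \<and> prob_space.indep_var P borel X0 borel W
      \<and> (\<forall>t\<ge>0. has_continuous_density P
                 (\<lambda>\<omega>. lambda_coef t *\<^sub>R X0 \<omega> + sigma_coef t *\<^sub>R W \<omega>) (q t))
      \<longrightarrow> (\<forall>\<alpha> :: 'd \<Rightarrow> nat. (\<Sum>i\<in>UNIV. \<alpha> i) \<le> l \<longrightarrow>
            (\<forall>x. \<forall>t\<ge>0. \<bar>multi_deriv xs \<alpha> (q t) x\<bar> / q t x \<le> C * norm x ^ l + C)))"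
proof -
  have "\<forall>k\<in>{1..M}. \<exists>h\<ge>1. \<forall>t\<ge>0. \<forall>v. norm (matrix_inv (noised_cov (A k) t) *v v) \<le> h * norm v"
    using noised_precision_bound[OF pos] by metis
  then obtain h where h: "\<And>k. k \<in> {1..M} \<Longrightarrow> 1 \<le> h k"
    "\<And>k t v. k \<in> {1..M} \<Longrightarrow> 0 \<le> t \<Longrightarrow> norm (matrix_inv (noised_cov (A k) t) *v v) \<le> h k * norm v"
    by metis
  \<comment> \<open>The sum dominates each summand, hence both |H e_i| and |H e_i . \<lambda> b_k|
    for every \<open>k\<close>, as \<lambda> is at most 1. Neither \<open>t\<close> nor the weights
    \<open>c\<close> enter.\<close>
  define L where "L = 1 + (\<Sum>k=1..M. h k * (1 + norm (b k)))"
  have h_nonneg: "0 \<le> h k * (1 + norm (b k))" if "k \<in> {1..M}" for k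
    using h(1)[OF that] by simp
  have hL: "h k * (1 + norm (b k)) \<le> L" if "k \<in> {1..M}" for k
    using member_le_sum[of k "{1..M}" "\<lambda>k. h k * (1 + norm (b k))"] that h_nonneg
    unfolding L_def by auto
  show ?thesis
  proof (intro exI allI impI, elim conjE)
    fix c :: "nat \<Rightarrow> real" and P :: "'p measure" and X0 W :: "'p \<Rightarrow> real^'d" and q
      and \<alpha> :: "'d \<Rightarrow> nat" and x and t :: real
    assume c: "\<forall>k\<in>{1..M}. 0 < c k"
      and P: "prob_space P" "distributed P lborel X0 (\<lambda>x. ennreal (gauss_mixture M c b A x))"
        "distributed P lborel W (\<lambda>x. ennreal (gauss_density 0 (mat 1) x))"
        "prob_space.indep_var P borel X0 borel W"
      and q: "\<forall>t\<ge>0. has_continuous_density P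
                 (\<lambda>\<omega>. lambda_coef t *\<^sub>R X0 \<omega> + sigma_coef t *\<^sub>R W \<omega>) (q t)"
      and \<alpha>: "(\<Sum>i\<in>UNIV. \<alpha> i) \<le> l" and t: "0 \<le> t"
    let ?H = "\<lambda>k. matrix_inv (noised_cov (A k) t)" and ?m = "\<lambda>k. lambda_coef t *\<^sub>R b k"
    obtain K where K: "\<And>k. k \<in> {1..M} \<Longrightarrow> 0 \<le> K k"
      and qt: "q t = (\<lambda>y. \<Sum>k=1..M. K k * exp (- (1/2) * ((y - ?m k) \<bullet> (?H k *v (y - ?m k)))))"
      using noised_mixture_density[OF P q[rule_format, OF t] pos] c t by blast
    have H_axis: "norm (?H k *v axis i 1) \<le> h k" if "k \<in> {1..M}" for k i
      using h(2)[OF that t, of "axis i 1"] by (simp add: norm_axis_1)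
    interpret gaussian_sum L "{1..M}" ?H ?m K
    proof
      show "1 \<le> L"
        unfolding L_def using sum_nonneg[of "{1..M}" "\<lambda>k. h k * (1 + norm (b k))"] h_nonneg by force
      show "x \<bullet> (?H k *v y) = (?H k *v x) \<bullet> y" if "k \<in> {1..M}" for k x y
        by (intro pos_def_inv_symmetric pos_def_noised_cov pos that t)
      show "norm (?H k *v axis i 1) \<le> L" if "k \<in> {1..M}" for k i
      proof -
        have "h k * 1 \<le> h k * (1 + norm (b k))"
          using h(1)[OF that] by (intro mult_left_mono) auto
        then show ?thesis
          using H_axis[OF that, of i] hL[OF that] by simp
      qed
      show "\<bar>(?H k *v axis i 1) \<bullet> ?m k\<bar> \<le> L" if "k \<in> {1..M}" for k i
      proof -
        have "\<bar>(?H k *v axis i 1) \<bullet> ?m k\<bar> \<le> norm (?H k *v axis i 1) * norm (?m k)"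
          by (rule Cauchy_Schwarz_ineq2)
        also have "norm (?m k) \<le> 1 * (1 + norm (b k))"
          using coef_bounds(1,2)[OF t] unfolding norm_scaleR by (intro mult_mono) auto
        then have "norm (?H k *v axis i 1) * norm (?m k) \<le> h k * (1 + norm (b k))"
          using H_axis[OF that] h(1)[OF that] by (intro mult_mono) auto
        finally show ?thesis
          using hL[OF that] by simp
      qed
    qed (use K in auto)
    have "q t = gsum"
      unfolding qt gsum_def gterm_def ..
    \<comment> \<open>This fixes the witness for \<open>C\<close>, built from \<open>L\<close> and
      \<open>l\<close> only.\<close>
    then show "\<bar>multi_deriv xs \<alpha> (q t) x\<bar> / q t x
        \<le> (deriv_weight L l * (2 * L) ^ l) * norm x ^ l + deriv_weight L l * (2 * L) ^ l"
      using multi_deriv_gsum_ratio[OF coords \<alpha>] by simp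
  qed
qed

end
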